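(* Let $\mathcal{C}$ be a covering of a finite set $U$ with $|U|=m$, such that there are no two distinct elements $u,v\in U$ with $\mathcal{C}(\{u\})=\mathcal{C}(\{v\})$ and $|\mathcal{C}(\{u\})|=1$. Let $\mathcal{L}$ be a uniform lattice with $L(\mathcal{C})\cong\mathcal{L}$, and suppose $|L^{(2)}(\mathcal{C})|<\binom{m}{2}$. If $\pi$ is an atom of $\mathcal{L}$, then $$|\mathcal{L}^{(2)}|=|L^{(2)}(\mathcal{C})|=\binom{|\mathcal{L}^{(1)}|}{2}-\left(\binom{|\mathcal{L}^{(1)}|-|\operatorname{Cov}(\pi)|+1}{2}-1\right)\cdot\frac{|\mathcal{L}^{(1)}|}{|\mathcal{L}^{(1)}|-|\operatorname{Cov}(\pi)|+1}.$$
   Context: A covering of a finite set $U$ is a collection $\mathcal{C}\subseteq 2^U$ of subsets of $U$ whose union is $U$. For $H\subseteq U$, $\mathcal{C}(H):=\{C\in\mathcal{C} : C\cap H\neq\emptyset\}$. The matroid $M(\mathcal{C})$ is the transversal matroid of $\mathcal{C}$ on the ground set $U$: its independent sets are the partial transversals of $\mathcal{C}$, i.e. the sets $I\subseteq U$ for which there is an injective map $\varphi:I\to\mathcal{C}$ with $e\in\varphi(e)$ for all $e\in I$. $L(\mathcal{C})$ is the lattice of closed sets (flats) of $M(\mathcal{C})$ ordered by inclusion. For a ranked lattice $\mathcal{L}$ with rank function $\operatorname{rk}$ (the height above the minimum element), $\mathcal{L}^{(\ell)}$ is the set of elements of rank $\ell$ (similarly $L^{(\ell)}(\mathcal{C})$),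 and $\operatorname{Cov}(y)$ is the set of elements covering $y$. $\mathcal{L}$ is uniform if $\operatorname{rk}(y)=\operatorname{rk}(z)$ implies $|\operatorname{Cov}(y)|=|\operatorname{Cov}(z)|$. *)

theory Defs
  imports Complex_Main "HOL-Library.Equipollence" "HOL-Algebra.Lattice"
begin

section \<open>Coverings and transversal matroids\<close>

definition covering :: "'a set \<Rightarrow> 'a set set \<Rightarrow> bool" where
  "covering U \<C> \<longleftrightarrow> \<C> \<subseteq> Pow U \<and> \<Union>\<C> = U"

text \<open>\<open>meeting \<C> H\<close> is what is usually written \<open>\<C>(H)\<close>.\<close>

definition meeting :: "'a set set \<Rightarrow> 'a set \<Rightarrow> 'a set set" where
  "meeting \<C> H = {C \<in> \<C>. C \<inter> H \<noteq> {}}"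

definition transversal_indep :: "'a set \<Rightarrow> 'a set set \<Rightarrow> 'a set \<Rightarrow> bool" where
  "transversal_indep U \<C> I \<longleftrightarrow>
     I \<subseteq> U \<and> (\<exists>\<phi>. inj_on \<phi> I \<and> \<phi> ` I \<subseteq> \<C> \<and> (\<forall>e\<in>I. e \<in> \<phi> e))"

text \<open>
  Rank, closure and flats of a matroid with finite ground set \<open>E\<close>, given by its
  independence predicate.
\<close>

definition matroid_rank :: "('a set \<Rightarrow> bool) \<Rightarrow> 'a set \<Rightarrow> nat" where
  "matroid_rank indep A = Max (card ` {I. I \<subseteq> A \<and> indep I})"

definition matroid_closure :: "'a set \<Rightarrow> ('a set \<Rightarrow> bool) \<Rightarrow> 'a set \<Rightarrow> 'a set" where
  "matroid_closure E indep A =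
     {x \<in> E. matroid_rank indep (insert x A) = matroid_rank indep A}"

definition flats :: "'a set \<Rightarrow> ('a set \<Rightarrow> bool) \<Rightarrow> 'a set set" where
  "flats E indep = {F. F \<subseteq> E \<and> matroid_closure E indep F = F}"

definition flat_lattice :: "'a set \<Rightarrow> 'a set set \<Rightarrow> 'a set gorder" where
  "flat_lattice U \<C> =
     \<lparr> carrier = flats U (transversal_indep U \<C>), eq = (=), le = (\<subseteq>) \<rparr>"


section \<open>Ranked and uniform lattices\<close>

definition order_isomorphic ::
  "('a, 'c) gorder_scheme \<Rightarrow> ('b, 'd) gorder_scheme \<Rightarrow> bool" where
  "order_isomorphic K L \<longleftrightarrow>
     (\<exists>f. bij_betw f (carrier K) (carrier L) \<and>
          (\<forall>x\<in>carrier K. \<forall>y\<in>carrier K. x \<sqsubseteq>\<^bsub>K\<^esub> y \<longleftrightarrow> f x \<sqsubseteq>\<^bsub>L\<^esub> f y))"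

definition Cov :: "('a, 'c) gorder_scheme \<Rightarrow> 'a \<Rightarrow> 'a set" where
  "Cov L y = {z \<in> carrier L. y \<sqsubset>\<^bsub>L\<^esub> z \<and>
                \<not> (\<exists>w\<in>carrier L. y \<sqsubset>\<^bsub>L\<^esub> w \<and> w \<sqsubset>\<^bsub>L\<^esub> z)}"

definition finite_chains_to :: "('a, 'c) gorder_scheme \<Rightarrow> 'a \<Rightarrow> 'a set set" where
  "finite_chains_to L x =
     {K. finite K \<and> K \<subseteq> carrier L \<and> x \<in> K \<and> (\<forall>y\<in>K. y \<sqsubseteq>\<^bsub>L\<^esub> x) \<and>
         (\<forall>y\<in>K. \<forall>z\<in>K. y \<sqsubseteq>\<^bsub>L\<^esub> z \<or> z \<sqsubseteq>\<^bsub>L\<^esub> y)}"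

text \<open>
  A chain with \<open>n + 1\<close> elements has length \<open>n\<close>. If there is a minimum element, a chain of
  maximal length ending in \<open>x\<close> starts there, so this is the height above the minimum.
\<close>

definition height :: "('a, 'c) gorder_scheme \<Rightarrow> 'a \<Rightarrow> nat" where
  "height L x = (SUP K\<in>finite_chains_to L x. card K - 1)"

definition level :: "('a, 'c) gorder_scheme \<Rightarrow> nat \<Rightarrow> 'a set" where
  "level L l = {x \<in> carrier L. height L x = l}"

definition atom :: "('a, 'c) gorder_scheme \<Rightarrow> 'a \<Rightarrow> bool" where
  "atom L p \<longleftrightarrow> (\<exists>b. least L b (carrier L) \<and> p \<in> Cov L b)"

text \<open>
  The boundedness condition says that all heights are finite; without it the supremum in
  \<^const>\<open>height\<close> would be unspecified. A function that vanishes at the minimum and grows by one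
  along covers can then only be \<^const>\<open>height\<close>, so it serves as the rank function.
\<close>

definition ranked_lattice :: "('a, 'c) gorder_scheme \<Rightarrow> bool" where
  "ranked_lattice L \<longleftrightarrow>
     lattice L \<and> (\<exists>b. least L b (carrier L)) \<and>
     (\<forall>x\<in>carrier L. bdd_above (card ` finite_chains_to L x)) \<and>
     (\<forall>x\<in>carrier L. \<forall>y\<in>Cov L x. height L y = height L x + 1)"

text \<open>Equipollence agrees with equality of \<^const>\<open>card\<close> when the sets of covers are finite.\<close>

definition uniform_lattice :: "('a, 'c) gorder_scheme \<Rightarrow> bool" where
  "uniform_lattice L \<longleftrightarrow>
     ranked_lattice L \<and>
     (\<forall>y\<in>carrier L. \<forall>z\<in>carrier L. height L y = height L z \<longrightarrow> Cov L y \<approx> Cov L z)"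

end

theory Submission
  imports Defs
begin

text \<open>
  The hypothesis on \<open>\<C>\<close> makes \<open>M(\<C>)\<close> simple, so its flats of rank one and two are the points
  and the lines of a linear space on \<open>U\<close>. A line with more than two points has the form
  \<open>{x. \<C>({x}) \<subseteq> D}\<close> with \<open>D\<close> a pair of members of \<open>\<C>\<close>. At most two of its points lie in only
  one member of \<open>\<C>\<close>, so it has a point \<open>w\<close> with \<open>\<C>({w}) = D\<close>, and no other long line passes
  through \<open>w\<close>. By uniformity every point lies on the same number \<open>k\<close> of lines; counting the
  points joined to \<open>w\<close> shows that all long lines have \<open>m - k + 1\<close> points, and counting at an
  arbitrary point then shows that it lies on exactly one long line. Hence the long lines
  partition \<open>U\<close>, and counting pairs of points in two ways gives the formula.
\<close>

section \<open>Counting lines in finite linear spaces\<close>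

locale finite_linear_space =
  fixes P :: "'a set" and Ls :: "'a set set"
  assumes finite_points: "finite P"
    and line_subset: "l \<in> Ls \<Longrightarrow> l \<subseteq> P"
    and line_card: "l \<in> Ls \<Longrightarrow> 2 \<le> card l"
    and line_unique: "\<lbrakk>l \<in> Ls; l' \<in> Ls; u \<noteq> v; u \<in> l; v \<in> l; u \<in> l'; v \<in> l'\<rbrakk> \<Longrightarrow> l = l'"
    and line_exists: "\<lbrakk>u \<in> P; v \<in> P; u \<noteq> v\<rbrakk> \<Longrightarrow> \<exists>l\<in>Ls. u \<in> l \<and> v \<in> l"
begin

lemma finite_lines: "finite Ls"
  using finite_points line_subset by (auto intro: finite_subset[of Ls "Pow P"])

lemma finite_line: "l \<in> Ls \<Longrightarrow> finite l"
  using finite_points line_subset finite_subset by blast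

text \<open>The lines through \<open>u\<close>, with \<open>u\<close> removed, partition the other
  points.\<close>

lemma sum_through_point:
  assumes "u \<in> P"
  shows "(\<Sum>l | l \<in> Ls \<and> u \<in> l. card l - 1) = card P - 1"
proof -
  have "P - {u} = (\<Union>l\<in>{l \<in> Ls. u \<in> l}. l - {u})"
    using line_subset line_exists[OF assms] by blast
  also have "card \<dots> = (\<Sum>l | l \<in> Ls \<and> u \<in> l. card (l - {u}))"
  proof (intro card_UN_disjoint ballI impI)
    fix l l' assume "l \<in> {l \<in> Ls. u \<in> l}" "l' \<in> {l \<in> Ls. u \<in> l}" "l \<noteq> l'"
    then show "(l - {u}) \<inter> (l' - {u}) = {}" using line_unique[of l l' _ u] by auto
  qed (simp_all add: finite_lines finite_line)
  also have "\<dots> = (\<Sum>l | l \<in> Ls \<and> u \<in> l. card l - 1)"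
    by (intro sum.cong) (auto simp: card_Diff_singleton)
  finally show ?thesis using assms by (simp add: card_Diff_singleton)
qed

text \<open>Every pair of points lies in exactly one line, so sorting the pairs by their lines
  counts each pair once.\<close>

lemma sum_pairs: "(\<Sum>l\<in>Ls. card l choose 2) = card P choose 2"
proof -
  have "{B. B \<subseteq> P \<and> card B = 2} = (\<Union>l\<in>Ls. {B. B \<subseteq> l \<and> card B = 2})"
  proof (intro equalityI subsetI)
    fix B assume "B \<in> {B. B \<subseteq> P \<and> card B = 2}"
    then obtain u v where "B = {u, v}" "u \<noteq> v" "u \<in> P" "v \<in> P" by (auto simp: card_2_iff)
    then show "B \<in> (\<Union>l\<in>Ls. {B. B \<subseteq> l \<and> card B = 2})" using line_exists[of u v] by auto
  qed (use line_subset in auto)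
  then have "card P choose 2 = card (\<Union>l\<in>Ls. {B. B \<subseteq> l \<and> card B = 2})"
    using n_subsets[OF finite_points, of 2] by simp
  also have "\<dots> = (\<Sum>l\<in>Ls. card {B. B \<subseteq> l \<and> card B = 2})"
  proof (intro card_UN_disjoint ballI impI)
    show "{B. B \<subseteq> l \<and> card B = 2} \<inter> {B. B \<subseteq> l' \<and> card B = 2} = {}"
      if "l \<in> Ls" "l' \<in> Ls" "l \<noteq> l'" for l l'
    proof (rule ccontr)
      assume "\<not> ?thesis"
      then obtain B where "B \<subseteq> l" "B \<subseteq> l'" "card B = 2" by auto
      then obtain u v where "u \<noteq> v" "{u, v} \<subseteq> l" "{u, v} \<subseteq> l'" by (metis card_2_iff)
      then show False using line_unique[OF that(1,2), of u v] that(3) by simp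
    qed
  qed (auto simp: finite_lines finite_line)
  also have "\<dots> = (\<Sum>l\<in>Ls. card l choose 2)"
    by (intro sum.cong) (auto simp: n_subsets finite_line)
  finally show ?thesis by simp
qed

text \<open>In \<open>sum_through_point\<close> a two-point line contributes 1 and a long line
  contributes \<open>1 + (s - 2)\<close>. The equation is read in both directions: at a private
  point it determines \<open>s\<close>, elsewhere the number of long lines.\<close>

lemma card_lines_through_point:
  assumes "u \<in> P" and "\<And>l. \<lbrakk>l \<in> Ls; u \<in> l; card l \<noteq> 2\<rbrakk> \<Longrightarrow> card l = s" and "3 \<le> s"
  shows "card {l \<in> Ls. u \<in> l} + card {l \<in> Ls. u \<in> l \<and> card l \<noteq> 2} * (s - 2) = card P - 1"
proof -
  let ?T = "{l \<in> Ls. u \<in> l}" and ?N = "{l \<in> Ls. u \<in> l \<and> card l \<noteq> 2}"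
  have "card P - 1 = (\<Sum>l\<in>?T. card l - 1)"
    using sum_through_point[OF assms(1)] by simp
  also have "\<dots> = (\<Sum>l\<in>?T. 1 + (if card l \<noteq> 2 then s - 2 else 0))"
    by (intro sum.cong refl) (use assms in auto)
  also have "\<dots> = card ?T + (\<Sum>l\<in>?T. if card l \<noteq> 2 then s - 2 else 0)"
    by (simp only: sum.distrib) simp
  also have "(\<Sum>l\<in>?T. if card l \<noteq> 2 then s - 2 else 0) = (\<Sum>l\<in>?N. s - 2)"
    using finite_lines by (subst sum.inter_filter[symmetric]) (auto intro!: sum.cong)
  finally show ?thesis by simp
qed

text \<open>The covering enters the counting only through \<open>private_point\<close>. The formula
  is stated over the reals so that its subtractions and its division are exact.\<close>

theorem card_lines_uniform:
  assumes "\<And>u. u \<in> P \<Longrightarrow> card {l \<in> Ls. u \<in> l} = k"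
    and private_point: "\<And>l. \<lbrakk>l \<in> Ls; card l \<noteq> 2\<rbrakk> \<Longrightarrow> \<exists>w\<in>l. \<forall>l'\<in>Ls. w \<in> l' \<longrightarrow> card l' \<noteq> 2 \<longrightarrow> l' = l"
    and few: "card Ls < card P choose 2"
  shows "real (card Ls) = (real (card P) gchoose 2)
      - (((real (card P) - real k + 1) gchoose 2) - 1) * (real (card P) / (real (card P) - real k + 1))"
proof -
  define N where "N = {l \<in> Ls. card l \<noteq> 2}"
  \<comment> \<open>The size forced by counting at a private point of a long line \<open>l\<close>:
    \<open>k + (card l - 2) = card P - 1\<close>.\<close>
  define s where "s = card P - k + 1"
  \<comment> \<open>The clause \<open>k \<le> card P\<close> is carried along because it makes the
    truncated subtraction in \<open>s\<close> exact.\<close>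
  have sizes: "card l = s \<and> 3 \<le> s \<and> k + (s - 2) = card P - 1 \<and> k \<le> card P" if "l \<in> Ls" "card l \<noteq> 2" for l
  proof -
    obtain w where w: "w \<in> l" "\<forall>l'\<in>Ls. w \<in> l' \<longrightarrow> card l' \<noteq> 2 \<longrightarrow> l' = l"
      using private_point[OF \<open>l \<in> Ls\<close> \<open>card l \<noteq> 2\<close>] by blast
    have l3: "3 \<le> card l" using line_card[OF \<open>l \<in> Ls\<close>] \<open>card l \<noteq> 2\<close> by linarith
    have wP: "w \<in> P" using w line_subset that by blast
    have N1: "{l' \<in> Ls. w \<in> l' \<and> card l' \<noteq> 2} = {l}" using that w by blast
    have "card l' = card l" if "l' \<in> Ls" "w \<in> l'" "card l' \<noteq> 2" for l' using w that by blast
    from card_lines_through_point[OF wP this l3] have "k + (card l - 2) = card P - 1"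
      unfolding N1 assms(1)[OF wP] by simp
    moreover have "0 < card P" using wP finite_points by (auto simp: card_gt_0_iff)
    ultimately show ?thesis using l3 unfolding s_def by linarith
  qed
  \<comment> \<open>Otherwise every term of \<open>sum_pairs\<close> is 1 and there are as many
    lines as pairs, against \<open>few\<close>. Any long line makes the numerical clauses of
    \<open>sizes\<close> available unconditionally.\<close>
  have "\<exists>l\<in>Ls. card l \<noteq> 2"
  proof (rule ccontr)
    assume "\<not> ?thesis"
    then have "(\<Sum>l\<in>Ls. card l choose 2) = (\<Sum>l\<in>Ls. 1)" by (intro sum.cong) auto
    then show False using sum_pairs few by simp
  qed
  then have s: "3 \<le> s" "k + (s - 2) = card P - 1" "k \<le> card P" using sizes by blast+
  have size: "card l = s" if "l \<in> Ls" "card l \<noteq> 2" for l using sizes[OF that] by blast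
  have Neq: "{l \<in> N. u \<in> l} = {l \<in> Ls. u \<in> l \<and> card l \<noteq> 2}" for u by (auto simp: N_def)
  \<comment> \<open>The count at \<open>u\<close> and the one at a private point differ only in the
    factor of \<open>s - 2\<close>, which is positive and cancels.\<close>
  have one: "card {l \<in> N. u \<in> l} = 1" if "u \<in> P" for u
  proof -
    have "k + card {l \<in> N. u \<in> l} * (s - 2) = card P - 1"
      using card_lines_through_point[OF that size s(1)] assms(1)[OF that] by (simp add: Neq)
    then have "card {l \<in> N. u \<in> l} * (s - 2) = 1 * (s - 2)" using s by linarith
    then show ?thesis using s(1) by (subst (asm) mult_cancel2) auto
  qed
  have finN: "finite N" using finite_lines by (simp add: N_def)
  have P: "card P = card N * s"
  proof -
    have "P = (\<Union>l\<in>N. l)"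
    proof
      show "P \<subseteq> (\<Union>l\<in>N. l)"
      proof
        fix u assume "u \<in> P"
        then have "{l \<in> N. u \<in> l} \<noteq> {}" using one[of u] by (auto simp del: Collect_empty_eq)
        then show "u \<in> (\<Union>l\<in>N. l)" by blast
      qed
    qed (use line_subset N_def in auto)
    moreover have "card (\<Union>l\<in>N. l) = (\<Sum>l\<in>N. card l)"
    proof (intro card_UN_disjoint ballI impI)
      fix l l' assume ll: "l \<in> N" "l' \<in> N" "l \<noteq> l'"
      show "l \<inter> l' = {}"
      proof (rule ccontr)
        assume "l \<inter> l' \<noteq> {}"
        then obtain u where u: "u \<in> l" "u \<in> l'" by blast
        then have "u \<in> P" using ll line_subset N_def by auto
        from one[OF this] obtain z where z: "{l \<in> N. u \<in> l} = {z}"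
          by (auto simp only: card_1_singleton_iff One_nat_def)
        have "l \<in> {z}" "l' \<in> {z}" unfolding z[symmetric] using ll u by simp_all
        then show False using ll(3) by simp
      qed
    qed (use finN N_def finite_line in auto)
    moreover have "(\<Sum>l\<in>N. card l) = (\<Sum>l\<in>N. s)"
      by (intro sum.cong) (use size N_def in auto)
    ultimately show ?thesis by simp
  qed
  \<comment> \<open>Pairs are split according to whether their line is long; each two-point line
    holds a single pair.\<close>
  have "card P choose 2 = (\<Sum>l\<in>N. card l choose 2) + (\<Sum>l\<in>Ls - N. card l choose 2)"
    using sum_pairs sum.subset_diff[of N Ls "\<lambda>l. card l choose 2"] finite_lines by (simp add: N_def)
  also have "(\<Sum>l\<in>N. card l choose 2) = (\<Sum>l\<in>N. s choose 2)"
    by (intro sum.cong) (use size N_def in auto)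
  also have "(\<Sum>l\<in>Ls - N. card l choose 2) = (\<Sum>l\<in>Ls - N. 1)"
    by (intro sum.cong) (auto simp: N_def)
  finally have "card P choose 2 = card N * (s choose 2) + card (Ls - N)" by simp
  moreover have "card Ls = card N + card (Ls - N)"
    using finite_lines card_Diff_subset[OF finN, of Ls] card_mono[of Ls N] by (auto simp: N_def)
  ultimately have "real (card Ls) = real (card P choose 2) - real (card N) * (real (s choose 2) - 1)"
    by (simp add: algebra_simps)
  moreover have "real (card N) = real (card P) / real s" using P s by simp
  moreover have "real s = real (card P) - real k + 1" using s unfolding s_def by simp
  ultimately show ?thesis by (simp add: binomial_gbinomial)
qed

end

section \<open>Order isomorphisms\<close>

text \<open>These orders carry their own equivalence \<open>eq\<close>, and strictness is defined by
  it. Fixing \<open>eq\<close> to equality on both sides lets strict order, and hence covers, be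
  transported.\<close>

locale order_iso =
  fixes K :: "('a, 'c) gorder_scheme" and L :: "('b, 'd) gorder_scheme" and f :: "'a \<Rightarrow> 'b"
  assumes bij: "bij_betw f (carrier K) (carrier L)"
    and le_iff: "\<lbrakk>x \<in> carrier K; y \<in> carrier K\<rbrakk> \<Longrightarrow> x \<sqsubseteq>\<^bsub>K\<^esub> y \<longleftrightarrow> f x \<sqsubseteq>\<^bsub>L\<^esub> f y"
    and eq_K: "eq K = (=)" and eq_L: "eq L = (=)"
begin

lemma inj: "inj_on f (carrier K)" and image: "f ` carrier K = carrier L"
  using bij by (auto simp: bij_betw_def)

text \<open>Chains are pulled back along \<open>f\<close>; injectivity keeps them finite. As
  \<open>height\<close> is a supremum over such chains, this is why \<open>f\<close> preserves
  it.\<close>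

lemma finite_chains_to_image:
  assumes "x \<in> carrier K"
  shows "finite_chains_to L (f x) = (`) f ` finite_chains_to K x"
proof (intro equalityI subsetI)
  fix X assume X: "X \<in> finite_chains_to L (f x)"
  define Y where "Y = {y \<in> carrier K. f y \<in> X}"
  have XY: "X = f ` Y" using X image by (auto simp: Y_def finite_chains_to_def)
  have "inj_on f Y" using inj by (rule inj_on_subset) (auto simp: Y_def)
  then have "finite Y" using X XY by (auto simp: finite_chains_to_def finite_image_iff)
  then have "Y \<in> finite_chains_to K x"
    using X assms by (auto simp: Y_def finite_chains_to_def le_iff)
  then show "X \<in> (`) f ` finite_chains_to K x" using XY by blast
next
  fix X assume "X \<in> (`) f ` finite_chains_to K x"
  then obtain Y where "Y \<in> finite_chains_to K x" "X = f ` Y" by blast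
  then show "X \<in> finite_chains_to L (f x)"
    using assms image unfolding finite_chains_to_def
    by (auto simp: le_iff[symmetric] subset_iff)
qed

lemma height_image: "x \<in> carrier K \<Longrightarrow> height L (f x) = height K x"
proof -
  assume x: "x \<in> carrier K"
  have "(\<lambda>X. card X - 1) ` (`) f ` finite_chains_to K x = (\<lambda>X. card X - 1) ` finite_chains_to K x"
    unfolding image_image
  proof (intro image_cong refl)
    fix X assume "X \<in> finite_chains_to K x"
    then have "inj_on f X" using inj by (auto simp: finite_chains_to_def intro: inj_on_subset)
    then show "card (f ` X) - 1 = card X - 1" by (simp add: card_image)
  qed
  then show ?thesis by (simp add: height_def finite_chains_to_image x)
qed

lemma level_image: "level L n = f ` level K n"
  unfolding level_def image[symmetric] by (auto simp: height_image)

lemma card_level: "card (level L n) = card (level K n)"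
  unfolding level_image by (intro card_image inj_on_subset[OF inj]) (auto simp: level_def)

lemma less_iff: "\<lbrakk>x \<in> carrier K; y \<in> carrier K\<rbrakk> \<Longrightarrow> f x \<sqsubset>\<^bsub>L\<^esub> f y \<longleftrightarrow> x \<sqsubset>\<^bsub>K\<^esub> y"
  using inj by (auto simp: lless_def le_iff eq_K eq_L inj_on_eq_iff)

lemma Cov_image: "y \<in> carrier K \<Longrightarrow> Cov L (f y) = f ` Cov K y"
  unfolding Cov_def image[symmetric] by (auto simp: less_iff)

lemma card_Cov: "y \<in> carrier K \<Longrightarrow> card (Cov L (f y)) = card (Cov K y)"
  using Cov_image[of y] by (auto simp: Cov_def intro!: card_image inj_on_subset[OF inj])

lemma least_image_iff: "b \<in> carrier K \<Longrightarrow> least L (f b) (carrier L) \<longleftrightarrow> least K b (carrier K)"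
  unfolding least_def image[symmetric] by (auto simp: le_iff)

lemma atom_image:
  assumes "atom L p"
  obtains a where "atom K a" "p = f a"
proof -
  obtain b' where b': "least L b' (carrier L)" "p \<in> Cov L b'" using assms by (auto simp: atom_def)
  then have "b' \<in> f ` carrier K" using image by (simp add: least_def)
  then obtain b where b: "b \<in> carrier K" "b' = f b" by blast
  then show thesis using that b' least_image_iff Cov_image unfolding atom_def by blast
qed

end

text \<open>A strictly increasing \<open>r\<close> is injective on a chain ending in
  \<open>x\<close> and takes values in \<open>{..r x}\<close> there, so the chain has at most
  \<open>r x + 1\<close> elements. Heights can thus be bounded without matroid rank theory.\<close>

lemma height_le_strict_mono:
  fixes r :: "'a \<Rightarrow> nat"
  assumes "x \<in> carrier K" "x \<sqsubseteq>\<^bsub>K\<^esub> x"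
    and mono: "\<And>y z. \<lbrakk>y \<in> carrier K; z \<in> carrier K; y \<sqsubseteq>\<^bsub>K\<^esub> z; y \<noteq> z\<rbrakk> \<Longrightarrow> r y < r z"
  shows "height K x \<le> r x"
  unfolding height_def
proof (rule cSUP_least)
  have "{x} \<in> finite_chains_to K x" using assms by (simp add: finite_chains_to_def)
  then show "finite_chains_to K x \<noteq> {}" by blast
  fix X assume X: "X \<in> finite_chains_to K x"
  have "inj_on r X"
  proof (rule inj_onI, rule ccontr)
    fix y z assume "y \<in> X" "z \<in> X" "r y = r z" "y \<noteq> z"
    then show False using X mono[of y z] mono[of z y] by (fastforce simp: finite_chains_to_def)
  qed
  then have "card X = card (r ` X)" by (simp add: card_image)
  also have "r y \<le> r x" if "y \<in> X" for y
    using X mono[of y x] assms(1) that by (cases "y = x") (fastforce simp: finite_chains_to_def)+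
  then have "card (r ` X) \<le> card {..r x}" by (intro card_mono) auto
  finally show "card X - 1 \<le> r x" by simp
qed

lemma le_height:
  assumes "finite (carrier K)" "X \<in> finite_chains_to K x"
  shows "card X - 1 \<le> height K x"
  unfolding height_def
proof (rule cSUP_upper[OF assms(2)])
  have "finite (finite_chains_to K x)"
    by (rule finite_subset[of _ "Pow (carrier K)"]) (auto simp: finite_chains_to_def assms)
  then show "bdd_above ((\<lambda>X. card X - 1) ` finite_chains_to K x)" by simp
qed

section \<open>Flats\<close>

lemma card_le_matroid_rank:
  assumes "finite A" "I \<subseteq> A" "indep I"
  shows "card I \<le> matroid_rank indep A"
  unfolding matroid_rank_def by (rule Max_ge) (use assms in auto)

lemma matroid_rank_le:
  assumes "finite A" "indep {}" "\<And>I. \<lbrakk>I \<subseteq> A; indep I\<rbrakk> \<Longrightarrow> card I \<le> n"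
  shows "matroid_rank indep A \<le> n"
  unfolding matroid_rank_def by (rule Max.boundedI) (use assms in auto)

lemma flat_iff:
  "F \<in> flats E indep \<longleftrightarrow>
     F \<subseteq> E \<and> (\<forall>x\<in>E - F. matroid_rank indep (insert x F) \<noteq> matroid_rank indep F)"
proof -
  have "matroid_rank indep (insert x F) = matroid_rank indep F" if "x \<in> F" for x
    using that by (simp add: insert_absorb)
  then show ?thesis unfolding flats_def matroid_closure_def by blast
qed

text \<open>The number \<open>n\<close> bounds the rank of \<open>F\<close>, and an independent set
  larger than \<open>n\<close> shows that \<open>x\<close> raises it. No rank has to be computed
  exactly.\<close>

lemma flatI:
  assumes "finite E" "F \<subseteq> E" "indep {}" "\<And>I. \<lbrakk>I \<subseteq> F; indep I\<rbrakk> \<Longrightarrow> card I \<le> n"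
    and "\<And>x. x \<in> E - F \<Longrightarrow> \<exists>I. I \<subseteq> insert x F \<and> indep I \<and> n < card I"
  shows "F \<in> flats E indep"
  unfolding flat_iff
proof (intro conjI ballI assms)
  fix x assume "x \<in> E - F"
  then obtain I where "I \<subseteq> insert x F" "indep I" "n < card I" using assms(5) by blast
  moreover have "finite F" using assms(1,2) by (rule rev_finite_subset)
  ultimately have "n < matroid_rank indep (insert x F)"
    using card_le_matroid_rank[of "insert x F" I indep] by simp
  moreover have "matroid_rank indep F \<le> n"
    using \<open>finite F\<close> assms(3,4) by (rule matroid_rank_le)
  ultimately show "matroid_rank indep (insert x F) \<noteq> matroid_rank indep F" by simp
qed

lemma transversal_indep_iff:
  "transversal_indep U \<C> I \<longleftrightarrow>
     I \<subseteq> U \<and> (\<exists>\<phi>. inj_on \<phi> I \<and> (\<forall>e\<in>I. \<phi> e \<in> meeting \<C> {e}))"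
proof -
  have "\<phi> ` I \<subseteq> \<C> \<and> (\<forall>e\<in>I. e \<in> \<phi> e) \<longleftrightarrow> (\<forall>e\<in>I. \<phi> e \<in> meeting \<C> {e})" for \<phi>
    by (auto simp: meeting_def)
  then show ?thesis by (simp add: transversal_indep_def)
qed

text \<open>The case of Hall's marriage theorem that is needed to show that pairs of points are flats.\<close>

lemma system_of_distinct_representatives_3:
  assumes AB: "3 \<le> card (A \<union> B)"
    and AC: "\<exists>a\<in>A. \<exists>c\<in>C. a \<noteq> c" and BC: "\<exists>b\<in>B. \<exists>c\<in>C. b \<noteq> c"
  shows "\<exists>a\<in>A. \<exists>b\<in>B. \<exists>c\<in>C. a \<noteq> b \<and> a \<noteq> c \<and> b \<noteq> c"
proof -
  obtain a c where ac: "a \<in> A" "c \<in> C" "a \<noteq> c" using AC by blast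
  obtain b c' where bc: "b \<in> B" "c' \<in> C" "b \<noteq> c'" using BC by blast
  \<comment> \<open>The three elements of \<open>A \<union> B\<close> leave some \<open>z\<close>
    outside \<open>{a, c}\<close>.\<close>
  have "\<not> A \<union> B \<subseteq> {a, c}"
    using AB ac card_mono[of "{a, c}" "A \<union> B"] by auto
  then obtain z where z: "z \<in> A \<union> B" "z \<noteq> a" "z \<noteq> c" by blast
  show ?thesis
  proof (cases "\<exists>b\<in>B. b \<noteq> a \<and> b \<noteq> c")
    case True
    then show ?thesis using ac by metis
  next
    case False
    \<comment> \<open>Now \<open>B \<subseteq> {a, c}\<close>, so \<open>z\<close> can represent
      \<open>A\<close> instead of \<open>a\<close>. Only if \<open>b = c\<close> and
      \<open>c' = z\<close> does \<open>a\<close> stay, and then \<open>z\<close> represents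
      \<open>C\<close>.\<close>
    then have "z \<in> A" using z by blast
    consider "b = a" | "b = c" using False bc by blast
    then show ?thesis
    proof cases
      case 1
      then show ?thesis using z \<open>z \<in> A\<close> ac bc by metis
    next
      case 2
      show ?thesis
      proof (cases "c' = z")
        case True
        then show ?thesis using z \<open>b = c\<close> ac bc by metis
      next
        case False
        then show ?thesis using z \<open>z \<in> A\<close> \<open>b = c\<close> bc by metis
      qed
    qed
  qed
qed

section \<open>Simple transversal matroids\<close>

text \<open>Since the members cover \<open>U\<close> there are no loops. Two points could be
  parallel only if both lay in one and the same single member, which \<open>simple\<close>
  excludes.\<close>

locale simple_covering =
  fixes U :: "'a set" and \<C> :: "'a set set"
  assumes finite_ground: "finite U" and covering: "covering U \<C>"
    and simple: "\<lbrakk>u \<in> U; v \<in> U; u \<noteq> v; meeting \<C> {u} = meeting \<C> {v}\<rbrakk> \<Longrightarrow> card (meeting \<C> {u}) \<noteq> 1"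
begin

section \<open>Points, lines and small independent sets\<close>

abbreviation S :: "'a \<Rightarrow> 'a set set" where "S u \<equiv> meeting \<C> {u}"
abbreviation indep :: "'a set \<Rightarrow> bool" where "indep \<equiv> transversal_indep U \<C>"
abbreviation K :: "'a set gorder" where "K \<equiv> flat_lattice U \<C>"

text \<open>An explicit form of the closure of \<open>{u, v}\<close>: if \<open>u\<close> and
  \<open>v\<close> meet only two members, a point confined to these cannot be independent of both;
  if they meet at least three, any third point can be added.\<close>

definition line :: "'a \<Rightarrow> 'a \<Rightarrow> 'a set" where
  "line u v = (if card (S u \<union> S v) = 2 then {x \<in> U. S x \<subseteq> S u \<union> S v} else {u, v})"

definition lines :: "'a set set" where
  "lines = {line u v |u v. u \<in> U \<and> v \<in> U \<and> u \<noteq> v}"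

lemma finite_S: "finite (S u)"
proof (rule finite_subset)
  show "S u \<subseteq> Pow U" using covering by (auto simp: covering_def meeting_def)
qed (use finite_ground in simp)

lemma S_nonempty: "u \<in> U \<Longrightarrow> \<exists>A. A \<in> S u"
  using covering by (auto simp: covering_def meeting_def)

text \<open>Without distinct representatives every element of \<open>S u\<close> equals every
  element of \<open>S v\<close>. Both sets are nonempty, so they would be the same singleton,
  against \<open>simple\<close>.\<close>

lemma distinct_representatives_2:
  assumes "u \<in> U" "v \<in> U" "u \<noteq> v"
  shows "\<exists>A\<in>S u. \<exists>B\<in>S v. A \<noteq> B"
proof (rule ccontr)
  assume neg: "\<not> ?thesis"
  obtain A B where AB: "A \<in> S u" "B \<in> S v" using S_nonempty assms by meson
  have eq: "X = Y" if "X \<in> S u" "Y \<in> S v" for X Y using neg that by metis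
  have "S u \<subseteq> {B}" by (rule subsetI) (use eq AB(2) in simp)
  then have "S u = {B}" using AB(1) subset_singletonD by fastforce
  moreover have "S v \<subseteq> {A}" by (rule subsetI) (use eq[OF AB(1)] in simp)
  then have "S v = {A}" using AB(2) subset_singletonD by fastforce
  ultimately have "S u = {A}" "S v = {A}" using AB(1) by simp_all
  then show False using simple[OF assms] by simp
qed

lemma indep_empty: "indep {}"
  by (simp add: transversal_indep_iff)

lemma indep_singleton:
  assumes "u \<in> U"
  shows "indep {u}"
proof -
  obtain A where "A \<in> S u" using S_nonempty[OF assms] by blast
  then show ?thesis
    using assms unfolding transversal_indep_iff by (intro conjI exI[of _ "\<lambda>_. A"]) auto
qed

lemma indep_triple:
  assumes "{u, v, w} \<subseteq> U" "distinct [u, v, w]" "A \<in> S u" "B \<in> S v" "C \<in> S w" "distinct [A, B, C]"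
  shows "indep {u, v, w}"
  unfolding transversal_indep_iff
proof (intro conjI exI)
  let ?\<phi> = "(\<lambda>e. if e = u then A else if e = v then B else C)"
  show "inj_on ?\<phi> {u, v, w}" using assms by (auto simp: inj_on_def)
  show "\<forall>e\<in>{u, v, w}. ?\<phi> e \<in> S e" using assms by auto
qed (use assms in auto)

lemma indep_pair:
  assumes "{u, v} \<subseteq> U" "u \<noteq> v"
  shows "indep {u, v}"
proof -
  obtain A B where "A \<in> S u" "B \<in> S v" "A \<noteq> B" using distinct_representatives_2[of u v] assms by auto
  then show ?thesis
    using assms unfolding transversal_indep_iff
    by (intro conjI exI[of _ "\<lambda>e. if e = u then A else B"]) (auto simp: inj_on_def)
qed

lemma card_S_Un:
  assumes "u \<in> U" "v \<in> U" "u \<noteq> v"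
  shows "2 \<le> card (S u \<union> S v)"
proof -
  obtain A B where "A \<in> S u" "B \<in> S v" "A \<noteq> B" using distinct_representatives_2[OF assms] by blast
  then show ?thesis using card_mono[of "S u \<union> S v" "{A, B}"] finite_S by auto
qed

lemma line_commute: "line u v = line v u"
  unfolding line_def by (simp add: Un_commute insert_commute)

lemma mem_line: "\<lbrakk>u \<in> U; v \<in> U\<rbrakk> \<Longrightarrow> u \<in> line u v \<and> v \<in> line u v"
  by (auto simp: line_def)

lemma line_subset_ground: "\<lbrakk>u \<in> U; v \<in> U\<rbrakk> \<Longrightarrow> line u v \<subseteq> U"
  by (auto simp: line_def)

text \<open>In the two-member case a line depends only on \<open>S u \<union> S v\<close>. The union
  for \<open>u'\<close> and \<open>v'\<close> lies inside it and has at least two elements by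
  \<open>card_S_Un\<close>, so the unions agree.\<close>

lemma line_eq:
  assumes "u \<in> U" "v \<in> U" "u' \<noteq> v'" "u' \<in> line u v" "v' \<in> line u v"
  shows "line u' v' = line u v"
proof (cases "card (S u \<union> S v) = 2")
  case True
  then have "u' \<in> U" "v' \<in> U" "S u' \<union> S v' \<subseteq> S u \<union> S v" using assms by (auto simp: line_def)
  moreover from this have "2 \<le> card (S u' \<union> S v')" using card_S_Un assms by simp
  ultimately have "S u' \<union> S v' = S u \<union> S v"
    using True finite_S by (intro card_seteq) auto
  then show ?thesis using True by (simp add: line_def)
next
  case False
  then have "u' \<in> {u, v}" "v' \<in> {u, v}" using assms by (auto simp: line_def)
  then have "u' = u \<and> v' = v \<or> u' = v \<and> v' = u" using assms(3) by auto
  then show ?thesis using line_commute by metis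
qed

section \<open>Points and lines are flats, and flats are closed under lines\<close>

lemma card_indep_le:
  assumes "indep I" "finite D" "\<And>x. x \<in> I \<Longrightarrow> S x \<subseteq> D"
  shows "card I \<le> card D"
proof -
  obtain \<phi> where "inj_on \<phi> I" "\<forall>e\<in>I. \<phi> e \<in> S e"
    using assms(1) by (auto simp: transversal_indep_iff)
  then show ?thesis using assms by (intro card_inj_on_le[of \<phi>]) auto
qed

lemma flat_empty: "{} \<in> flats U indep"
proof (rule flatI[of U _ _ 0])
  fix x assume "x \<in> U - {}"
  then show "\<exists>I\<subseteq>insert x {}. indep I \<and> 0 < card I"
    using indep_singleton[of x] by (intro exI[of _ "{x}"]) auto
qed (auto simp: finite_ground indep_empty)

lemma flat_singleton:
  assumes "u \<in> U"
  shows "{u} \<in> flats U indep"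
proof (rule flatI[of U _ _ 1])
  fix x assume "x \<in> U - {u}"
  then show "\<exists>I\<subseteq>insert x {u}. indep I \<and> 1 < card I"
    using indep_pair[of x u] assms by (intro exI[of _ "{x, u}"]) auto
next
  fix I assume "I \<subseteq> {u}"
  then show "card I \<le> 1" using card_mono[of "{u}" I] by simp
qed (auto simp: finite_ground indep_empty assms)

text \<open>Two members cannot represent three points, so the rank is at most two; a point off the
  line completes \<open>u\<close> and \<open>v\<close> to an independent triple.\<close>

lemma flat_line:
  assumes "u \<in> U" "v \<in> U" "u \<noteq> v"
  shows "line u v \<in> flats U indep"
proof (rule flatI[of U _ _ 2])
  show "card I \<le> 2" if "I \<subseteq> line u v" "indep I" for I
  proof (cases "card (S u \<union> S v) = 2")
    case True
    then have "S x \<subseteq> S u \<union> S v" if "x \<in> I" for x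
      using \<open>I \<subseteq> line u v\<close> that by (auto simp: line_def)
    then show ?thesis using card_indep_le[OF that(2), of "S u \<union> S v"] True finite_S by simp
  next
    case False
    then have "card I \<le> card {u, v}" using that by (intro card_mono) (auto simp: line_def)
    then show ?thesis using assms(3) by simp
  qed
next
  fix x assume "x \<in> U - line u v"
  then have x: "x \<in> U" "x \<noteq> u" "x \<noteq> v" "x \<notin> line u v" using mem_line assms by auto
  have "\<exists>A\<in>S u. \<exists>B\<in>S v. \<exists>C\<in>S x. A \<noteq> B \<and> A \<noteq> C \<and> B \<noteq> C"
  proof (cases "card (S u \<union> S v) = 2")
    case True
    \<comment> \<open>Being off the line means that \<open>S x\<close> has an element outside the
      two, which cannot clash with representatives of \<open>u\<close> and \<open>v\<close>.\<close>
    then obtain C where "C \<in> S x" "C \<notin> S u \<union> S v" using x by (auto simp: line_def)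
    moreover obtain A B where "A \<in> S u" "B \<in> S v" "A \<noteq> B"
      using distinct_representatives_2[OF assms] by blast
    ultimately show ?thesis by (metis UnCI)
  next
    case False
    then have "3 \<le> card (S u \<union> S v)" using card_S_Un[OF assms] by linarith
    then show ?thesis
      by (rule system_of_distinct_representatives_3) (use x assms distinct_representatives_2 in auto)
  qed
  then obtain A B C where "A \<in> S u" "B \<in> S v" "C \<in> S x" "distinct [A, B, C]" by auto
  then have "indep {u, v, x}" using x assms by (intro indep_triple) auto
  then show "\<exists>I\<subseteq>insert x (line u v). indep I \<and> 2 < card I"
    using x assms mem_line by (intro exI[of _ "{u, v, x}"]) auto
qed (simp_all add: finite_ground line_subset_ground assms indep_empty)

text \<open>Every representative available to \<open>x\<close> is also available to \<open>u\<close>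
  or \<open>v\<close>, so \<open>x\<close> can be traded for one of them. This will show that
  \<open>x\<close> adds no rank to a set containing \<open>u\<close> and \<open>v\<close>.\<close>

lemma indep_exchange:
  assumes I: "indep I" "x \<in> I" and uv: "u \<in> U" "v \<in> U" "u \<noteq> v"
    and D: "card (S u \<union> S v) = 2" "S x \<subseteq> S u \<union> S v" and x: "x \<noteq> u" "x \<noteq> v"
  shows "\<exists>J. J \<subseteq> insert u (insert v (I - {x})) \<and> indep J \<and> card J = card I"
proof -
  obtain \<phi> where \<phi>: "inj_on \<phi> I" "\<forall>e\<in>I. \<phi> e \<in> S e" and IU: "I \<subseteq> U"
    using I(1) by (auto simp: transversal_indep_iff)
  have finI: "finite I" using IU finite_ground finite_subset by blast
  \<comment> \<open>The points \<open>a\<close> and \<open>x\<close> use up both members of the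
    pair. The rest of \<open>I\<close> avoids them, so they can be redistributed to \<open>a\<close>
    and \<open>b\<close>.\<close>
  have swap: "\<exists>J. J \<subseteq> insert a (insert b (I - {x})) \<and> indep J \<and> card J = card I"
    if a: "a \<in> I" "b \<notin> I" "a \<in> U" "b \<in> U" "a \<noteq> b" "a \<noteq> x" and Dab: "S a \<union> S b = S u \<union> S v" for a b
  proof -
    obtain A B where AB: "A \<in> S a" "B \<in> S b" "A \<noteq> B"
      using distinct_representatives_2[of a b] a by blast
    have card2: "card (S a \<union> S b) = 2" using D Dab by simp
    have "{A, B} = S a \<union> S b"
      by (rule card_seteq) (use AB card2 finite_S in auto)
    moreover have "\<phi> a \<noteq> \<phi> x" using \<phi>(1) a I(2) by (auto simp: inj_on_eq_iff)
    then have "{\<phi> a, \<phi> x} = S a \<union> S b"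
      by (intro card_seteq) (use \<phi> a card2 finite_S I D Dab in auto)
    ultimately have AB': "{A, B} = {\<phi> a, \<phi> x}" by simp
    have other: "\<phi> e \<notin> {A, B}" if "e \<in> I" "e \<noteq> a" "e \<noteq> x" for e
      unfolding AB' using \<phi>(1) that a(1) I(2) by (auto simp: inj_on_eq_iff)
    let ?J = "insert b (I - {x})" and ?\<psi> = "\<phi>(a := A, b := B)"
    have "inj_on ?\<psi> ?J"
    proof (rule inj_onI)
      fix y z assume "y \<in> ?J" "z \<in> ?J" "?\<psi> y = ?\<psi> z"
      then show "y = z"
        using other[of y] other[of z] AB(3) a \<phi>(1) by (auto simp: inj_on_eq_iff split: if_splits)
    qed
    moreover have "\<forall>e\<in>?J. ?\<psi> e \<in> S e" using \<phi>(2) AB by auto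
    ultimately have "indep ?J"
      unfolding transversal_indep_iff using IU a by (intro conjI exI[of _ ?\<psi>]) auto
    moreover have "card ?J = card I" using card.remove[OF finI I(2)] a(2) finI by simp
    ultimately show ?thesis by blast
  qed
  \<comment> \<open>Here \<open>w\<close> simply inherits the representative of
    \<open>x\<close>.\<close>
  have move: "\<exists>J. J \<subseteq> insert u (insert v (I - {x})) \<and> indep J \<and> card J = card I"
    if w: "w \<in> {u, v}" "w \<notin> I" "\<phi> x \<in> S w" for w
  proof -
    let ?J = "insert w (I - {x})" and ?\<psi> = "\<phi>(w := \<phi> x)"
    have "inj_on ?\<psi> ?J"
    proof (rule inj_onI)
      fix y z assume "y \<in> ?J" "z \<in> ?J" "?\<psi> y = ?\<psi> z"
      then show "y = z"
        using w \<phi>(1) I(2) by (auto simp: inj_on_eq_iff split: if_splits)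
    qed
    moreover have "\<forall>e\<in>?J. ?\<psi> e \<in> S e" using \<phi>(2) w by auto
    ultimately have "indep ?J"
      unfolding transversal_indep_iff using IU w uv by (intro conjI exI[of _ ?\<psi>]) auto
    moreover have "card ?J = card I" using card.remove[OF finI I(2)] w(2) finI by simp
    moreover have "?J \<subseteq> insert u (insert v (I - {x}))" using w by auto
    ultimately show ?thesis by blast
  qed
  have \<phi>x: "\<phi> x \<in> S u \<union> S v" using \<phi>(2) I(2) D(2) by blast
  consider "u \<in> I" "v \<in> I" | "u \<in> I" "v \<notin> I" | "u \<notin> I" "v \<in> I" | "u \<notin> I" "v \<notin> I" by blast
  then show ?thesis
  proof cases
    case 1
    \<comment> \<open>Impossible case: three points would need distinct representatives among two
      members.\<close>
    have "inj_on \<phi> {u, v, x}" by (rule inj_on_subset[OF \<phi>(1)]) (use 1 I(2) in auto)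
    moreover have "\<phi> ` {u, v, x} \<subseteq> S u \<union> S v" using \<phi>(2) 1 \<phi>x by auto
    ultimately have "card {u, v, x} \<le> card (S u \<union> S v)" using finite_S by (intro card_inj_on_le) auto
    moreover have "card {u, v, x} = 3" using x uv by auto
    ultimately show ?thesis using D(1) by simp
  next
    case 2
    then show ?thesis using swap[of u v] uv x by simp
  next
    case 3
    then show ?thesis using swap[of v u] uv x by (simp add: insert_commute[of v u] Un_commute)
  next
    case 4
    from \<phi>x consider "\<phi> x \<in> S u" | "\<phi> x \<in> S v" by blast
    then show ?thesis using move[of u] move[of v] 4 by cases simp_all
  qed
qed

text \<open>By exchange, independent subsets of \<open>insert x F\<close> are no larger than those
  of \<open>F\<close>, so a point \<open>x\<close> of the line does not raise the rank and belongs
  to the flat. With \<open>flat_line\<close>, this makes the line the least flat containing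
  \<open>u\<close> and \<open>v\<close>.\<close>

lemma line_subset_flat:
  assumes F: "F \<in> flats U indep" and uv: "u \<in> F" "v \<in> F" "u \<noteq> v"
  shows "line u v \<subseteq> F"
proof (cases "card (S u \<union> S v) = 2")
  case True
  have FU: "F \<subseteq> U" using F by (simp add: flat_iff)
  then have finF: "finite F" using finite_ground finite_subset by blast
  show ?thesis
  proof (rule subsetI, rule ccontr)
    fix x assume x: "x \<in> line u v" "x \<notin> F"
    have xU: "x \<in> U" and Sx: "S x \<subseteq> S u \<union> S v" using x True by (auto simp: line_def)
    have "card I \<le> matroid_rank indep F" if I: "I \<subseteq> insert x F" "indep I" for I
    proof (cases "x \<in> I")
      case True
      obtain J where J: "J \<subseteq> insert u (insert v (I - {x}))" "indep J" "card J = card I"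
        using indep_exchange[OF I(2) True, of u v] Sx \<open>card (S u \<union> S v) = 2\<close> uv FU x by blast
      have "J \<subseteq> F" using J(1) I(1) uv by auto
      then show ?thesis using card_le_matroid_rank[of F J indep] finF J by simp
    next
      case False
      then have "I \<subseteq> F" using I by auto
      then show ?thesis using card_le_matroid_rank[of F I indep] finF I by simp
    qed
    then have "matroid_rank indep (insert x F) \<le> matroid_rank indep F"
      using finF indep_empty by (intro matroid_rank_le) auto
    moreover have "matroid_rank indep F \<le> matroid_rank indep (insert x F)"
      using finF indep_empty by (intro matroid_rank_le card_le_matroid_rank) auto
    ultimately have "matroid_rank indep (insert x F) = matroid_rank indep F" by simp
    then show False using F xU x(2) by (simp add: flat_iff)
  qed
next
  case False
  then show ?thesis using uv by (simp add: line_def)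
qed

lemma lines_cases:
  assumes "l \<in> lines"
  obtains u v where "l = line u v" "u \<in> U" "v \<in> U" "u \<noteq> v"
  using assms unfolding lines_def mem_Collect_eq by (elim exE conjE)

lemma line_eq_member:
  assumes "l \<in> lines" "u \<noteq> v" "u \<in> l" "v \<in> l"
  shows "line u v = l"
proof -
  obtain a b where "l = line a b" "a \<in> U" "b \<in> U" using assms(1) by (rule lines_cases)
  then show ?thesis using line_eq[of a b u v] assms by simp
qed

lemma line_mem_lines: "\<lbrakk>u \<in> U; v \<in> U; u \<noteq> v\<rbrakk> \<Longrightarrow> line u v \<in> lines"
  unfolding lines_def mem_Collect_eq by (rule exI[of _ u], rule exI[of _ v]) simp

section \<open>The linear space of the matroid and its private points\<close>

sublocale finite_linear_space U lines
proof
  fix l l' u v assume "l \<in> lines" "l' \<in> lines" "u \<noteq> v" "u \<in> l" "v \<in> l" "u \<in> l'" "v \<in> l'"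
  then show "l = l'" using line_eq_member[of l u v] line_eq_member[of l' u v] by simp
next
  fix l assume "l \<in> lines"
  then obtain u v where l: "l = line u v" "u \<in> U" "v \<in> U" "u \<noteq> v" by (rule lines_cases)
  then have "{u, v} \<subseteq> l" using mem_line by simp
  moreover have "finite l" using l line_subset_ground finite_ground finite_subset by metis
  ultimately have "card {u, v} \<le> card l" by (intro card_mono)
  then show "2 \<le> card l" using l by simp
  show "l \<subseteq> U" using l line_subset_ground by simp
next
  fix u v assume "u \<in> U" "v \<in> U" "u \<noteq> v"
  then show "\<exists>l\<in>lines. u \<in> l \<and> v \<in> l"
    using mem_line line_mem_lines by (intro bexI[of _ "line u v"]) auto
qed (rule finite_ground)

lemma private_point:
  assumes "l \<in> lines" "card l \<noteq> 2"
  shows "\<exists>w\<in>l. \<forall>l'\<in>lines. w \<in> l' \<longrightarrow> card l' \<noteq> 2 \<longrightarrow> l' = l"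
proof -
  \<comment> \<open>Only the two-member branch of \<open>line\<close> can produce more than two
    points.\<close>
  have long_lines: "\<exists>D. card D = 2 \<and> l = {x \<in> U. S x \<subseteq> D}" if "l \<in> lines" "card l \<noteq> 2" for l
  proof -
    obtain u v where l: "l = line u v" "u \<in> U" "v \<in> U" "u \<noteq> v"
      using \<open>l \<in> lines\<close> by (rule lines_cases)
    then have "card (S u \<union> S v) = 2" using \<open>card l \<noteq> 2\<close> by (auto simp: line_def split: if_splits)
    then show ?thesis using l(1) by (intro exI[of _ "S u \<union> S v"]) (simp add: line_def)
  qed
  obtain D where D: "card D = 2" "l = {x \<in> U. S x \<subseteq> D}" using long_lines[OF assms] by blast
  have finD: "finite D" using D(1) by (simp add: card_ge_0_finite)
  \<comment> \<open>Otherwise the sets \<open>S x\<close> are singletons inside \<open>D\<close>,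
    distinct by \<open>simple\<close>, and there is room for only two points.\<close>
  have "\<exists>w\<in>l. S w = D"
  proof (rule ccontr)
    assume neg: "\<not> ?thesis"
    have S1: "card (S x) = 1" if "x \<in> l" for x
    proof -
      have "S x \<subset> D" using neg that D by auto
      then have "card (S x) < 2" using psubset_card_mono[OF finD, of "S x"] D(1) by simp
      moreover have "x \<in> U" using that D(2) by simp
      then have "S x \<noteq> {}" using S_nonempty by blast
      then have "0 < card (S x)" using finite_S by (simp add: card_gt_0_iff)
      ultimately show ?thesis by linarith
    qed
    have "inj_on S l"
    proof (rule inj_onI, rule ccontr)
      fix x y assume "x \<in> l" "y \<in> l" "S x = S y" "x \<noteq> y"
      then show False using simple[of x y] S1[of x] D(2) by auto
    qed
    moreover have "S ` l \<subseteq> {X. X \<subseteq> D \<and> card X = 1}" using S1 D(2) by auto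
    ultimately have "card l \<le> card {X. X \<subseteq> D \<and> card X = 1}"
      using finD by (intro card_inj_on_le) auto
    also have "\<dots> = 2" using n_subsets[OF finD, of 1] D(1) by simp
    finally show False using line_card[OF assms(1)] assms(2) by simp
  qed
  then obtain w where w: "w \<in> l" "S w = D" by blast
  \<comment> \<open>The pair \<open>D'\<close> of \<open>l'\<close> contains \<open>S w = D\<close>,
    so the pairs agree, and the pair determines the line.\<close>
  have "l' = l" if l': "l' \<in> lines" "w \<in> l'" "card l' \<noteq> 2" for l'
  proof -
    obtain D' where D': "card D' = 2" "l' = {x \<in> U. S x \<subseteq> D'}" using long_lines[OF l'(1,3)] by blast
    have "finite D'" using D'(1) by (simp add: card_ge_0_finite)
    moreover have "D \<subseteq> D'" using l'(2) D'(2) w(2) by simp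
    ultimately have "D = D'" using D(1) D'(1) by (intro card_seteq) auto
    then show ?thesis using D D' by simp
  qed
  then show ?thesis using w by blast
qed

section \<open>Heights and covers in the lattice of flats\<close>

lemma carrier_K: "carrier K = flats U indep" and le_K: "F \<sqsubseteq>\<^bsub>K\<^esub> G \<longleftrightarrow> F \<subseteq> G"
  and eq_K: "eq K = (=)"
  by (simp_all add: flat_lattice_def)

lemma less_K: "F \<sqsubset>\<^bsub>K\<^esub> G \<longleftrightarrow> F \<subset> G"
  by (auto simp: lless_def le_K eq_K)

lemma flat_subset_ground: "F \<in> flats U indep \<Longrightarrow> F \<subseteq> U"
  by (simp add: flat_iff)

lemma finite_carrier_K: "finite (carrier K)"
  unfolding carrier_K
  by (rule finite_subset[of _ "Pow U"]) (use flat_subset_ground finite_ground in auto)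

lemma lines_flats: "lines \<subseteq> flats U indep"
  using flat_line lines_cases by (metis subsetI)

text \<open>Two distinct points of \<open>F\<close> would span all of \<open>l\<close> inside
  \<open>F\<close>.\<close>

lemma lines_minimal:
  assumes "l \<in> lines" "F \<in> flats U indep" "F \<subset> l" "u \<in> F" "v \<in> F"
  shows "u = v"
proof (rule ccontr)
  assume "u \<noteq> v"
  then have "line u v = l" using line_eq_member[OF assms(1)] assms(3-5) by auto
  then show False using line_subset_flat[OF assms(2,4,5) \<open>u \<noteq> v\<close>] assms(3) by auto
qed

text \<open>Cardinality is strictly increasing on flats. Lowering it to 2 on lines keeps this true,
  since a flat properly inside a line has at most one point by \<open>lines_minimal\<close>.\<close>

lemma height_le:
  assumes "F \<in> flats U indep"
  shows "height K F \<le> (if F \<in> lines then 2 else card F)"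
proof (rule height_le_strict_mono[where r = "\<lambda>F. if F \<in> lines then 2 else card F"])
  fix F G assume "F \<in> carrier K" "G \<in> carrier K" "F \<sqsubseteq>\<^bsub>K\<^esub> G" "F \<noteq> G"
  then have FG: "F \<in> flats U indep" "G \<in> flats U indep" "F \<subset> G" by (auto simp: carrier_K le_K)
  have "finite G" using FG(2) flat_subset_ground finite_ground finite_subset by blast
  then have less: "card F < card G" using FG(3) by (rule psubset_card_mono)
  have small: "card F \<le> 1" if "G \<in> lines"
    using lines_minimal[OF that FG(1,3)] \<open>finite G\<close> FG(3)
    by (metis One_nat_def card_le_Suc0_iff_eq finite_subset psubset_imp_subset)
  show "(if F \<in> lines then 2 else card F) < (if G \<in> lines then 2 else card G)"
    using less small line_card[of F] by (auto split: if_splits)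
qed (use assms in \<open>auto simp: carrier_K le_K\<close>)

lemma height_singleton: "u \<in> U \<Longrightarrow> height K {u} = 1"
proof (rule antisym)
  assume u: "u \<in> U"
  have "{u} \<notin> lines" using line_card[of "{u}"] by auto
  then show "height K {u} \<le> 1" using height_le[OF flat_singleton[OF u]] by simp
  have "{{}, {u}} \<in> finite_chains_to K {u}"
    using u flat_empty flat_singleton by (simp add: finite_chains_to_def carrier_K le_K)
  from le_height[OF finite_carrier_K this] show "1 \<le> height K {u}" by simp
qed

text \<open>The chain \<open>{}\<close>, \<open>{u}\<close>, \<open>l\<close>, \<open>F\<close> has
  four elements, or three if its last step collapses.\<close>

lemma height_ge:
  assumes F: "F \<in> flats U indep" and u: "u \<in> U" and l: "l \<in> lines" "u \<in> l" "l \<subseteq> F"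
  shows "2 \<le> height K F" "F \<noteq> l \<Longrightarrow> 3 \<le> height K F"
proof -
  have ul: "{u} \<noteq> l" using line_card[OF l(1)] by auto
  let ?X = "{{}, {u}, l, F}"
  have "?X \<in> finite_chains_to K F"
    using F u l lines_flats flat_empty flat_singleton by (auto simp: finite_chains_to_def carrier_K le_K)
  from le_height[OF finite_carrier_K this] have X: "card ?X - 1 \<le> height K F" .
  have ne: "{} \<noteq> l" "{} \<noteq> {u}" "{} \<noteq> F" "{u} \<noteq> F" using l ul by auto
  show "2 \<le> height K F"
  proof (cases "F = l")
    case True
    then have "card ?X = 3" using ne ul by simp
    then show ?thesis using X by linarith
  next
    case False
    then have "card ?X = 4" using ne ul by auto
    then show ?thesis using X by linarith
  qed
  show "3 \<le> height K F" if "F \<noteq> l"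
  proof -
    have "card ?X = 4" using that ne ul by auto
    then show ?thesis using X by linarith
  qed
qed

text \<open>A flat with two points contains their line; the third case supplies exactly the premises
  of \<open>height_ge\<close>.\<close>

lemma flat_cases:
  assumes F: "F \<in> flats U indep"
  obtains "F = {}" | u where "u \<in> U" "F = {u}"
  | u l where "u \<in> U" "l \<in> lines" "u \<in> l" "l \<subseteq> F"
proof -
  consider "F = {}" | u where "F = {u}" | u v where "u \<in> F" "v \<in> F" "u \<noteq> v" by blast
  then show thesis
  proof cases
    case 3
    then have "u \<in> U" "v \<in> U" using flat_subset_ground[OF F] by auto
    then have "line u v \<in> lines" "u \<in> line u v" using 3 mem_line by (auto simp: line_mem_lines)
    then show thesis using that(3) \<open>u \<in> U\<close> line_subset_flat[OF F 3] by blast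
  qed (use that flat_subset_ground[OF F] in auto)
qed

lemma height_empty: "height K {} = 0"
  using height_le[OF flat_empty] line_card[of "{}"] by (auto split: if_splits)

lemma level_1: "level K 1 = (\<lambda>u. {u}) ` U"
proof (intro equalityI subsetI)
  fix F assume "F \<in> level K 1"
  then have F: "F \<in> flats U indep" "height K F = 1" by (auto simp: level_def carrier_K)
  from F(1) show "F \<in> (\<lambda>u. {u}) ` U"
  proof (cases rule: flat_cases)
    case (3 u l)
    then show ?thesis using height_ge(1)[OF F(1) 3] F(2) by simp
  qed (use F height_empty in auto)
qed (auto simp: level_def carrier_K flat_singleton height_singleton)

lemma level_2: "level K 2 = lines"
proof (intro equalityI subsetI)
  fix F assume "F \<in> level K 2"
  then have F: "F \<in> flats U indep" "height K F = 2" by (auto simp: level_def carrier_K)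
  from F(1) show "F \<in> lines"
  proof (cases rule: flat_cases)
    case (3 u l)
    then show ?thesis using height_ge(2)[OF F(1) 3] F(2) by (cases "F = l") auto
  qed (use F height_empty height_singleton in auto)
next
  fix l assume l: "l \<in> lines"
  then obtain u where u: "u \<in> U" "u \<in> l" using mem_line lines_cases by metis
  have flat: "l \<in> flats U indep" using l lines_flats by auto
  have "height K l = 2"
    using height_le[OF flat] height_ge(1)[OF flat u(1) l u(2)] l by simp
  then show "l \<in> level K 2" using flat by (simp add: level_def carrier_K)
qed

text \<open>A flat covering \<open>{a}\<close> has a further point \<open>v\<close>, hence contains
  \<open>line a v\<close>, and nothing fits strictly between. Conversely
  \<open>lines_minimal\<close> leaves no flat between \<open>{a}\<close> and a line.\<close>

lemma Cov_singleton:
  assumes "a \<in> U"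
  shows "Cov K {a} = {l \<in> lines. a \<in> l}"
proof (intro equalityI subsetI)
  fix F assume "F \<in> Cov K {a}"
  then have F: "F \<in> flats U indep" "{a} \<subset> F"
    and max: "\<And>G. \<lbrakk>G \<in> flats U indep; {a} \<subset> G\<rbrakk> \<Longrightarrow> \<not> G \<subset> F"
    by (auto simp: Cov_def carrier_K less_K)
  obtain v where v: "v \<in> F" "v \<noteq> a" "a \<in> F" using F(2) by auto
  then have vU: "v \<in> U" using F(1) flat_subset_ground by auto
  have "line a v \<subseteq> F" using line_subset_flat[OF F(1)] v by simp
  moreover have "{a} \<subset> line a v" using mem_line[OF assms vU] v by auto
  then have "\<not> line a v \<subset> F" using max flat_line[OF assms vU] v by simp
  ultimately have "F = line a v" by auto
  then show "F \<in> {l \<in> lines. a \<in> l}" using v vU assms mem_line line_mem_lines by auto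
next
  fix l assume "l \<in> {l \<in> lines. a \<in> l}"
  then have l: "l \<in> lines" "a \<in> l" by auto
  have "{a} \<noteq> l" using line_card[OF l(1)] by auto
  moreover have False if "F \<in> flats U indep" "{a} \<subset> F" "F \<subset> l" for F
    using lines_minimal[OF l(1) that(1,3)] that(2) by blast
  ultimately show "l \<in> Cov K {a}" using l lines_flats by (auto simp: Cov_def carrier_K less_K)
qed

lemma atom_singleton:
  assumes "atom K p"
  obtains a where "a \<in> U" "p = {a}"
proof -
  obtain b where b: "least K b (carrier K)" "p \<in> Cov K b" using assms by (auto simp: atom_def)
  have "b = {}" using b(1) flat_empty by (auto simp: least_def carrier_K le_K)
  then have p: "p \<in> flats U indep" "p \<noteq> {}" and max: "\<And>G. \<lbrakk>G \<in> flats U indep; {} \<subset> G\<rbrakk> \<Longrightarrow> \<not> G \<subset> p"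
    using b(2) by (auto simp: Cov_def carrier_K less_K)
  obtain a where a: "a \<in> p" using p by auto
  then have aU: "a \<in> U" using p flat_subset_ground by auto
  have "\<not> {a} \<subset> p" using max[OF flat_singleton[OF aU]] by auto
  then have "p = {a}" using a by auto
  then show thesis using that aU by blast
qed

end

section \<open>The formula for uniform lattices\<close>

theorem theorem4p9:
  fixes U :: "'a set" and \<C> :: "'a set set" and m :: nat
    and \<L> :: "('b, 'c) gorder_scheme" and p :: 'b
  assumes "finite U" and "card U = m"
    and "covering U \<C>"
    and "\<not> (\<exists>u\<in>U. \<exists>v\<in>U. u \<noteq> v \<and> meeting \<C> {u} = meeting \<C> {v} \<and> card (meeting \<C> {u}) = 1)"
    and "uniform_lattice \<L>"
    and "order_isomorphic (flat_lattice U \<C>) \<L>"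
    and "card (level (flat_lattice U \<C>) 2) < m choose 2"
    and "atom \<L> p"
  shows "card (level \<L> 2) = card (level (flat_lattice U \<C>) 2) \<and>
    real (card (level (flat_lattice U \<C>) 2)) =
      (real (card (level \<L> 1)) gchoose 2)
      - (((real (card (level \<L> 1)) - real (card (Cov \<L> p)) + 1) gchoose 2) - 1)
        * (real (card (level \<L> 1)) / (real (card (level \<L> 1)) - real (card (Cov \<L> p)) + 1))"
proof -
  interpret simple_covering U \<C> by unfold_locales (use assms in auto)
  obtain f where f: "bij_betw f (carrier K) (carrier \<L>)"
    "\<forall>x\<in>carrier K. \<forall>y\<in>carrier K. x \<sqsubseteq>\<^bsub>K\<^esub> y \<longleftrightarrow> f x \<sqsubseteq>\<^bsub>\<L>\<^esub> f y"
    using assms(6) unfolding order_isomorphic_def by blast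
  have "lattice \<L>" using assms(5) by (simp add: uniform_lattice_def ranked_lattice_def)
  then have "partial_order \<L>" by (simp add: lattice_def upper_semilattice_def)
  then have "eq \<L> = (=)" by (rule partial_order.eq_is_equal)
  then interpret iso: order_iso K \<L> f by unfold_locales (use f eq_K in auto)
  obtain a where a: "a \<in> U" "p = f {a}" using iso.atom_image[OF assms(8)] atom_singleton by metis
  have Cov_f: "card (Cov \<L> (f {u})) = card {l \<in> lines. u \<in> l}" if "u \<in> U" for u
    using iso.card_Cov Cov_singleton[OF that] flat_singleton[OF that] by (simp add: carrier_K)
  \<comment> \<open>All points have height 1, so uniformity gives their images equally many covers;
    back in the flat lattice these covers are the lines through the point.\<close>
  have "card {l \<in> lines. u \<in> l} = card (Cov \<L> p)" if u: "u \<in> U" for u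
  proof -
    have "{u} \<in> carrier K" "{a} \<in> carrier K" using flat_singleton a u by (simp_all add: carrier_K)
    then have "f {u} \<in> carrier \<L>" "f {a} \<in> carrier \<L>" "height \<L> (f {u}) = height \<L> (f {a})"
      using iso.image iso.height_image height_singleton a u by auto
    then have "Cov \<L> (f {u}) \<approx> Cov \<L> p" using assms(5) a by (auto simp: uniform_lattice_def)
    then have "card (Cov \<L> (f {u})) = card (Cov \<L> p)"
      by (auto simp: eqpoll_def bij_betw_same_card)
    then show ?thesis using Cov_f[OF u] by simp
  qed
  moreover have "card lines < card U choose 2" using assms(2,7) level_2 by simp
  ultimately have "real (card lines) = (real (card U) gchoose 2)
      - (((real (card U) - real (card (Cov \<L> p)) + 1) gchoose 2) - 1)
        * (real (card U) / (real (card U) - real (card (Cov \<L> p)) + 1))"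
    by (intro card_lines_uniform private_point)
  moreover have "card (level \<L> 1) = card U"
    unfolding iso.card_level level_1 by (simp add: card_image)
  ultimately show ?thesis by (simp add: iso.card_level level_2)
qed

end
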